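(* Let $X$ be a treatment variable with $m$ values $x_1,\dots,x_m$ and $Y$ an effect variable with $n$ values $y_1,\dots,y_n$ in a structural causal model. Let $k\ge 2$, let $1\le i_1,\dots,i_k\le n$, and let $1\le j_1,\dots,j_k\le m$ be pairwise distinct. Put $S=\{(i_1,j_1),\dots,(i_k,j_k)\}$, $S_{-t}=S\setminus\{(i_t,j_t)\}$ and $J=\{j_1,\dots,j_k\}$. With the recursively defined quantities $L(\cdot),U(\cdot),L(\cdot\,;p),U(\cdot\,;p),L(\cdot\,;p,q),U(\cdot\,;p,q)$ of the context, the probability $P(Y_{x_{j_1}}=y_{i_1},\dots,Y_{x_{j_k}}=y_{i_k})$ is at least the maximum of the four quantities (1) $0$; (2) $\sum_{t=1}^{k}P(Y_{x_{j_t}}=y_{i_t})-k+1$; (3) $\max_{1\le t\le k}\big(L(S_{-t})+P(Y_{x_{j_t}}=y_{i_t})-1\big)$; (4) $\sum_{r=1}^{k}L(S_{-r};j_r,i_r)+\sum_{1\le p\le m,\ p\notin J}L(S;p)$; and at most the minimum of the three quantities (1') $\min_{1\le t\le k}P(Y_{x_{j_t}}=y_{i_t})$; (2') $\min_{1\le t\le k}U(S_{-t})$; (3') $\sum_{r=1}^{k}U(S_{-r};j_r,i_r)+\sum_{1\le p\le m,\ p\notin J}U(S;p)$.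
   Context: Setting. $Y_{x_j}$ denotes the counterfactual (potential outcome) variable "the value $Y$ would have, had $X$ been $x_j$". The structural causal model induces one probability space $P$ on which $X$, $Y$, and $Y_{x_1},\dots,Y_{x_m}$ (each with values in $\{y_1,\dots,y_n\}$) are jointly defined, and they satisfy consistency: on the event $X=x_j$ one has $Y_{x_j}=Y$. The values $x_1,\dots,x_m$ are distinct, as are $y_1,\dots,y_n$. Recursive bounds. Throughout, $S=\{(i_1,j_1),\dots,(i_k,j_k)\}$ with $k\ge1$, $1\le i_t\le n$, $1\le j_t\le m$ and $j_1,\dots,j_k$ pairwise distinct; $J=\{j_1,\dots,j_k\}$; $S_{-t}=S\setminus\{(i_t,j_t)\}$; $S_t=\{(i_t,j_t)\}$; $1\le p\le m$ with $p\notin J$; $1\le q\le n$. Write $a_t=P(Y_{x_{j_t}}=y_{i_t})$, and write $P(x_p)$ for $P(X=x_p)$ and $P(x_p,y_q)$ for $P(X=x_p,Y=y_q)$. $L(S),U(S)$ are the lower and upper bounds used for $P(Y_{x_{j_1}}=y_{i_1},\dots,Y_{x_{j_k}}=y_{i_k})$; $L(S;p),U(S;p)$ those used for $P(Y_{x_{j_1}}=y_{i_1},\dots,Y_{x_{j_k}}=y_{i_k},X=x_p)$; $L(S;p,q),U(S;p,q)$ those used for $P(Y_{x_{j_1}}=y_{i_1},\dots,Y_{x_{j_k}}=y_{i_k},X=x_p,Y=y_q)$. They are the following numbers, defined by recursion on $k$. Case $k=1$, $S=\{(i,j)\}$, $a=P(Y_{x_j}=y_i)$: $L(S)=U(S)=a$;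 $L(S;p)=\max\{0,\ a-P(x_j,y_i)-1+P(x_j)+P(x_p)\}$; $U(S;p)=\min\{a-P(x_j,y_i),\ P(x_p)\}$; $L(S;p,q)=\max\{0,\ a+P(x_p,y_q)-1+P(x_j)-P(x_j,y_i)\}$; $U(S;p,q)=\min\{a-P(x_j,y_i),\ P(x_p,y_q)\}$. Case $k\ge2$: $L(S;p)=\max\{0,\ \sum_{t}a_t+P(x_p)-k,\ \max_{t}(L(S_{-t})+L(S_t;p)-1)\}$; $U(S;p)=\min\{\min_t a_t,\ P(x_p),\ \min_t U(S_{-t}),\ \min_t U(S_t;p)\}$; $L(S;p,q)=\max\{0,\ \sum_{t}a_t+P(x_p,y_q)-k,\ \max_{t}(L(S_{-t})+L(S_t;p,q)-1)\}$; $U(S;p,q)=\min\{\min_t a_t,\ P(x_p,y_q),\ \min_t U(S_{-t}),\ \min_t U(S_t;p,q)\}$; $L(S)=\max\{0,\ \sum_t a_t-k+1,\ \max_t(L(S_{-t})+a_t-1),\ \sum_{r=1}^kL(S_{-r};j_r,i_r)+\sum_{p\notin J}L(S;p)\}$; $U(S)=\min\{\min_t a_t,\ \min_tU(S_{-t}),\ \sum_{r=1}^kU(S_{-r};j_r,i_r)+\sum_{p\notin J}U(S;p)\}$, where $t$ ranges over $1,\dots,k$ and $p\notin J$ means $p\in\{1,\dots,m\}\setminus J$. *)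

theory Defs
  imports "HOL-Probability.Probability"
begin

(* Observations live on a single probability space M; X and Y are the factual variables and
   Yc v is the counterfactual (potential outcome) "Y, had X been v". Only the consequences of
   the underlying structural causal model that are relevant here are recorded: all variables
   are jointly defined, take the listed values, and satisfy consistency. *)
locale potential_outcomes = prob_space M for M :: "'w measure" +
  fixes m n :: nat
    and x :: "nat \<Rightarrow> 'a" and y :: "nat \<Rightarrow> 'b"
    and X :: "'w \<Rightarrow> 'a" and Y :: "'w \<Rightarrow> 'b" and Yc :: "'a \<Rightarrow> 'w \<Rightarrow> 'b"
  assumes x_inj: "inj_on x {1..m}"
    and y_inj: "inj_on y {1..n}"
    and X_measurable: "X \<in> measurable M (count_space (x ` {1..m}))"
    and Y_measurable: "Y \<in> measurable M (count_space (y ` {1..n}))"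
    and Yc_measurable: "\<And>j. j \<in> {1..m} \<Longrightarrow> Yc (x j) \<in> measurable M (count_space (y ` {1..n}))"
    and consistency: "\<And>j \<omega>. j \<in> {1..m} \<Longrightarrow> \<omega> \<in> space M \<Longrightarrow> X \<omega> = x j \<Longrightarrow> Yc (x j) \<omega> = Y \<omega>"

(* The recursive bounds depend only on the following numbers:
     a i j   = P(Y_{x_j} = y_i),   px p = P(X = x_p),   pxy p q = P(X = x_p, Y = y_q).
   A set S of pairs (i, j) encodes the conjunction of the events Y_{x_j} = y_i; the functions
   with suffix _x and _xy are the bounds for this conjunction together with X = x_p and with
   X = x_p, Y = y_q respectively. The branches for card S < 2 are meant for singletons; the
   values at empty or infinite S are irrelevant, as the recursion never reaches them from a
   finite nonempty S. *)
context
  fixes m :: nat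
    and a :: "nat \<Rightarrow> nat \<Rightarrow> real" and px :: "nat \<Rightarrow> real" and pxy :: "nat \<Rightarrow> nat \<Rightarrow> real"
begin

function lower :: "(nat \<times> nat) set \<Rightarrow> real"
  and lower_x :: "(nat \<times> nat) set \<Rightarrow> nat \<Rightarrow> real"
  and lower_xy :: "(nat \<times> nat) set \<Rightarrow> nat \<Rightarrow> nat \<Rightarrow> real"
where
  "lower S =
     (if card S \<ge> 2 then
        Max {0,
             (\<Sum>(i, j)\<in>S. a i j) - real (card S) + 1,
             (MAX (i, j)\<in>S. lower (S - {(i, j)}) + a i j - 1),
             (\<Sum>(i, j)\<in>S. lower_xy (S - {(i, j)}) j i) + (\<Sum>p\<in>{1..m} - snd ` S. lower_x S p)}
      else (case the_elem S of (i, j) \<Rightarrow> a i j))"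
| "lower_x S p =
     (if card S \<ge> 2 then
        Max {0,
             (\<Sum>(i, j)\<in>S. a i j) + px p - real (card S),
             (MAX s\<in>S. lower (S - {s}) + lower_x {s} p - 1)}
      else (case the_elem S of (i, j) \<Rightarrow> Max {0, a i j - pxy j i - 1 + px j + px p}))"
| "lower_xy S p q =
     (if card S \<ge> 2 then
        Max {0,
             (\<Sum>(i, j)\<in>S. a i j) + pxy p q - real (card S),
             (MAX s\<in>S. lower (S - {s}) + lower_xy {s} p q - 1)}
      else (case the_elem S of (i, j) \<Rightarrow> Max {0, a i j + pxy p q - 1 + px j - pxy j i}))"
  by pat_completeness auto
termination
  by (relation "Wellfounded.measure (case_sum (\<lambda>S. 2 * card S + 1)
        (case_sum (\<lambda>(S, p). 2 * card S) (\<lambda>(S, p, q). 2 * card S)))")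
     (auto simp: card_Diff_singleton_if)

function upper :: "(nat \<times> nat) set \<Rightarrow> real"
  and upper_x :: "(nat \<times> nat) set \<Rightarrow> nat \<Rightarrow> real"
  and upper_xy :: "(nat \<times> nat) set \<Rightarrow> nat \<Rightarrow> nat \<Rightarrow> real"
where
  "upper S =
     (if card S \<ge> 2 then
        Min {(MIN (i, j)\<in>S. a i j),
             (MIN s\<in>S. upper (S - {s})),
             (\<Sum>(i, j)\<in>S. upper_xy (S - {(i, j)}) j i) + (\<Sum>p\<in>{1..m} - snd ` S. upper_x S p)}
      else (case the_elem S of (i, j) \<Rightarrow> a i j))"
| "upper_x S p =
     (if card S \<ge> 2 then
        Min {(MIN (i, j)\<in>S. a i j),
             px p,
             (MIN s\<in>S. upper (S - {s})),
             (MIN s\<in>S. upper_x {s} p)}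
      else (case the_elem S of (i, j) \<Rightarrow> Min {a i j - pxy j i, px p}))"
| "upper_xy S p q =
     (if card S \<ge> 2 then
        Min {(MIN (i, j)\<in>S. a i j),
             pxy p q,
             (MIN s\<in>S. upper (S - {s})),
             (MIN s\<in>S. upper_xy {s} p q)}
      else (case the_elem S of (i, j) \<Rightarrow> Min {a i j - pxy j i, pxy p q}))"
  by pat_completeness auto
termination
  by (relation "Wellfounded.measure (case_sum (\<lambda>S. 2 * card S + 1)
        (case_sum (\<lambda>(S, p). 2 * card S) (\<lambda>(S, p, q). 2 * card S)))")
     (auto simp: card_Diff_singleton_if)

end

declare lower.simps [simp del] lower_x.simps [simp del] lower_xy.simps [simp del]
declare upper.simps [simp del] upper_x.simps [simp del] upper_xy.simps [simp del]

end

theory Submission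
  imports Defs
begin

text \<open>
  Splitting over the values of \<open>X\<close> is exact, and by consistency the part with \<open>X = x j\<close> of the
  event \<open>Yc (x j) = y i\<close> is the factual event \<open>X = x j, Y = y i\<close>; this gives the last entry of
  \<open>lower\<close> and \<open>upper\<close>. All remaining entries are monotonicity or
  \<open>P(A \<inter> B) \<ge> P(A) + P(B) - 1\<close>, where for singletons that inequality is sharpened by noting that
  both events live in the complement of \<open>X = x j\<close>. Soundness of the bounds then follows by
  induction on the number of conjuncts.
\<close>

text \<open>Inclusion-exclusion together with \<open>prob (A \<union> B) \<le> 1\<close>.\<close>

lemma (in prob_space) prob_Int_ge:
  assumes "A \<in> events" "B \<in> events"
  shows "prob A + prob B - 1 \<le> prob (A \<inter> B)"
  using finite_measure_Union'[OF assms] finite_measure_Diff'[OF assms(2,1)]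
    prob_le_1[of "A \<union> B"] by (simp add: Int_commute)

section \<open>Events and their measurability\<close>

context potential_outcomes
begin

text \<open>Sets of pairs match the arguments of \<open>lower\<close> and \<open>upper\<close>,
  whose recursion deletes one pair at a time; the empty conjunction is the whole space and starts
  the inductions over \<open>S\<close>.\<close>

definition cf_event :: "(nat \<times> nat) set \<Rightarrow> 'w set"
  where "cf_event S = {\<omega> \<in> space M. \<forall>(i, j)\<in>S. Yc (x j) \<omega> = y i}"

definition treatment_event :: "nat \<Rightarrow> 'w set"
  where "treatment_event p = {\<omega> \<in> space M. X \<omega> = x p}"

definition factual_event :: "nat \<Rightarrow> nat \<Rightarrow> 'w set"
  where "factual_event p q = {\<omega> \<in> space M. X \<omega> = x p \<and> Y \<omega> = y q}"

text \<open>The three probabilities are spelled out as comprehensions so that unfolding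
  \<open>a\<close>, \<open>px\<close> and \<open>pxy\<close> in the theorem produces literally these
  terms.\<close>

abbreviation cf_prob :: "nat \<Rightarrow> nat \<Rightarrow> real"
  where "cf_prob \<equiv> \<lambda>i j. prob {\<omega> \<in> space M. Yc (x j) \<omega> = y i}"

abbreviation treatment_prob :: "nat \<Rightarrow> real"
  where "treatment_prob \<equiv> \<lambda>p. prob {\<omega> \<in> space M. X \<omega> = x p}"

abbreviation factual_prob :: "nat \<Rightarrow> nat \<Rightarrow> real"
  where "factual_prob \<equiv> \<lambda>p q. prob {\<omega> \<in> space M. X \<omega> = x p \<and> Y \<omega> = y q}"

lemma prob_treatment_event: "treatment_prob p = prob (treatment_event p)"
  by (simp add: treatment_event_def)

lemma prob_factual_event: "factual_prob p q = prob (factual_event p q)"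
  by (simp add: factual_event_def)

lemma prob_cf_event_singleton: "cf_prob i j = prob (cf_event {(i, j)})"
  by (simp add: cf_event_def)

text \<open>The invariant of the recursion: the bounds carry no information at the empty set, and
  \<open>inj_on snd S\<close> says that no treatment value occurs twice.\<close>

definition admissible :: "(nat \<times> nat) set \<Rightarrow> bool"
  where "admissible S \<longleftrightarrow> finite S \<and> S \<noteq> {} \<and> inj_on snd S \<and> snd ` S \<subseteq> {1..m}"

lemma measurable_eq_event:
  assumes "f \<in> measurable M (count_space A)"
  shows "{\<omega> \<in> space M. f \<omega> = c} \<in> events"
proof -
  \<comment> \<open>Intersecting \<open>{c}\<close> with \<open>A\<close> yields a set of the count
    space even when \<open>c\<close> lies outside \<open>A\<close>, where the event is
    empty.\<close>
  have "{\<omega> \<in> space M. f \<omega> = c} = f -` ({c} \<inter> A) \<inter> space M"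
    using measurable_space[OF assms] by auto
  then show ?thesis using measurable_sets[OF assms, of "{c} \<inter> A"] by simp
qed

lemma treatment_event_measurable [simp]: "treatment_event p \<in> events"
  unfolding treatment_event_def by (rule measurable_eq_event[OF X_measurable])

lemma factual_event_measurable [simp]: "factual_event p q \<in> events"
proof -
  have "factual_event p q = treatment_event p \<inter> {\<omega> \<in> space M. Y \<omega> = y q}"
    by (auto simp: factual_event_def treatment_event_def)
  then show ?thesis using measurable_eq_event[OF Y_measurable] by (auto intro!: sets.Int)
qed

lemma cf_event_empty [simp]: "cf_event {} = space M"
  by (simp add: cf_event_def)

lemma cf_event_insert: "cf_event (insert s S) = cf_event {s} \<inter> cf_event S"
  by (auto simp: cf_event_def)

lemma cf_event_remove: "s \<in> S \<Longrightarrow> cf_event S = cf_event {s} \<inter> cf_event (S - {s})"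
  by (metis cf_event_insert insert_Diff)

lemma cf_event_antimono: "T \<subseteq> S \<Longrightarrow> cf_event S \<subseteq> cf_event T"
  by (auto simp: cf_event_def)

lemma cf_event_measurable [simp]:
  assumes "finite S" "snd ` S \<subseteq> {1..m}"
  shows "cf_event S \<in> events"
  using assms
proof (induction S rule: finite_induct)
  case (insert s S)
  obtain i j where s: "s = (i, j)" by fastforce
  have "cf_event {s} \<in> events"
    using measurable_eq_event[OF Yc_measurable[of j]] insert.prems by (simp add: s cf_event_def)
  then show ?case using insert cf_event_insert[of s S] by auto
qed simp

text \<open>Iterating \<open>prob_Int_ge\<close>, every conjunct costs 1; the final
  \<open>+ 1\<close> is the probability of the empty conjunction.\<close>

lemma prob_cf_event_ge:
  assumes "finite S" "snd ` S \<subseteq> {1..m}"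
  shows "(\<Sum>(i, j)\<in>S. cf_prob i j) - real (card S) + 1 \<le> prob (cf_event S)"
  using assms
proof (induction S rule: finite_induct)
  case (insert s S)
  obtain i j where s: "s = (i, j)" by fastforce
  have "prob (cf_event {s}) + prob (cf_event S) - 1 \<le> prob (cf_event (insert s S))"
    unfolding cf_event_insert[of s S] using insert.hyps insert.prems by (intro prob_Int_ge) auto
  then show ?case using insert by (simp add: s prob_cf_event_singleton)
qed (simp add: prob_space)

section \<open>Consistency and the sharpened inequalities\<close>

lemma consistency_event:
  assumes "j \<in> {1..m}"
  shows "cf_event {(i, j)} \<inter> treatment_event j = factual_event j i"
  using consistency[OF assms] by (auto simp: cf_event_def treatment_event_def factual_event_def)

text \<open>Explains the difference \<open>a i j - pxy j i\<close> in the singleton bounds: by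
  consistency, the part of the counterfactual event removed here is the factual event.\<close>

lemma prob_cf_event_off_treatment:
  assumes "j \<in> {1..m}"
  shows "prob (cf_event {(i, j)} - treatment_event j) = cf_prob i j - factual_prob j i"
proof -
  have "cf_event {(i, j)} \<in> events" using assms by simp
  from finite_measure_Diff'[OF this treatment_event_measurable, of j]
  show ?thesis
    unfolding prob_cf_event_singleton prob_factual_event by (simp only: consistency_event[OF assms])
qed

lemma prob_cf_event_singleton_Int_le:
  assumes "j \<in> {1..m}" "B \<inter> treatment_event j = {}"
  shows "prob (cf_event {(i, j)} \<inter> B) \<le> cf_prob i j - factual_prob j i"
  unfolding prob_cf_event_off_treatment[OF assms(1), symmetric]
  by (rule finite_measure_mono) (use assms in auto)

lemma prob_cf_event_singleton_Int_ge:
  assumes "j \<in> {1..m}" "B \<in> events" "B \<inter> treatment_event j = {}"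
  shows "cf_prob i j - factual_prob j i - 1 + treatment_prob j + prob B
    \<le> prob (cf_event {(i, j)} \<inter> B)"
proof -
  let ?A = "cf_event {(i, j)}" and ?T = "treatment_event j"
  have A: "?A \<in> events" using assms by simp
  \<comment> \<open>Adding \<open>?T\<close> to \<open>B\<close> gains \<open>prob ?T\<close> in
    \<open>prob_Int_ge\<close>, while removing it from \<open>?A\<close> costs only
    \<open>prob (?A \<inter> ?T)\<close>; the intersection stays the same.\<close>
  have "?A \<inter> B = (?A - ?T) \<inter> (B \<union> ?T)" using assms(3) by auto
  moreover have "prob (?A - ?T) + prob (B \<union> ?T) - 1 \<le> prob ((?A - ?T) \<inter> (B \<union> ?T))"
    using A assms(2) by (intro prob_Int_ge) auto
  moreover have "prob (B \<union> ?T) = prob B + prob ?T"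
    using assms by (intro finite_measure_Union) auto
  ultimately show ?thesis
    using prob_cf_event_off_treatment[OF assms(1), of i] unfolding prob_treatment_event by simp
qed

text \<open>\<open>B\<close> is attached to the single conjunct because the sharpened bounds
  \<open>lower_x {s} p\<close> and \<open>lower_xy {s} p q\<close> live there.\<close>

lemma prob_cf_event_Int_ge_remove:
  assumes "finite S" "snd ` S \<subseteq> {1..m}" "s \<in> S" "B \<in> events"
  shows "prob (cf_event (S - {s})) + prob (cf_event {s} \<inter> B) - 1 \<le> prob (cf_event S \<inter> B)"
proof -
  have "cf_event S \<inter> B = cf_event (S - {s}) \<inter> (cf_event {s} \<inter> B)"
    using cf_event_remove[OF assms(3)] by auto
  moreover have "cf_event {s} \<in> events" "cf_event (S - {s}) \<in> events"
    using assms by (auto intro!: cf_event_measurable)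
  ultimately show ?thesis using assms(4) prob_Int_ge by (metis sets.Int)
qed

lemma prob_cf_event_Int_mono:
  assumes "finite S" "snd ` S \<subseteq> {1..m}" "T \<subseteq> S" "B \<in> events"
  shows "prob (cf_event S \<inter> B) \<le> prob (cf_event T \<inter> B)"
    and "prob (cf_event S \<inter> B) \<le> prob (cf_event T)"
proof -
  have "cf_event T \<in> events"
    using assms by (intro cf_event_measurable) (auto dest: finite_subset)
  then show "prob (cf_event S \<inter> B) \<le> prob (cf_event T \<inter> B)"
    and "prob (cf_event S \<inter> B) \<le> prob (cf_event T)"
    using cf_event_antimono[OF assms(3)] assms(4) by (auto intro!: finite_measure_mono)
qed

section \<open>Splitting over the values of the treatment\<close>

lemma treatment_event_disjoint:
  assumes "p \<in> {1..m}" "q \<in> {1..m}" "p \<noteq> q"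
  shows "treatment_event p \<inter> treatment_event q = {}"
  using assms inj_on_eq_iff[OF x_inj] by (auto simp: treatment_event_def)

lemma factual_event_subset: "factual_event p q \<subseteq> treatment_event p"
  by (auto simp: factual_event_def treatment_event_def)

lemma space_eq_UN_treatment_event: "space M = (\<Union>p\<in>{1..m}. treatment_event p)"
  using measurable_space[OF X_measurable] by (auto simp: treatment_event_def)

text \<open>Total probability over \<open>X\<close>. When \<open>X = x j\<close> for a pair
  \<open>(i, j)\<close> of \<open>S\<close>, that conjunct becomes \<open>Y = y i\<close>, which
  accounts for the arguments of \<open>lower_xy (S - {(i, j)}) j i\<close> in the recursion.\<close>

lemma prob_cf_event_split:
  assumes "finite S" "inj_on snd S" "snd ` S \<subseteq> {1..m}"
  shows "prob (cf_event S) =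
    (\<Sum>(i, j)\<in>S. prob (cf_event (S - {(i, j)}) \<inter> factual_event j i))
      + (\<Sum>p\<in>{1..m} - snd ` S. prob (cf_event S \<inter> treatment_event p))"
proof -
  have "cf_event S = (\<Union>p\<in>{1..m}. cf_event S \<inter> treatment_event p)"
    using space_eq_UN_treatment_event by (auto simp: cf_event_def)
  moreover have "prob (\<Union>p\<in>{1..m}. cf_event S \<inter> treatment_event p)
      = (\<Sum>p\<in>{1..m}. prob (cf_event S \<inter> treatment_event p))"
  proof (rule finite_measure_finite_Union)
    show "disjoint_family_on (\<lambda>p. cf_event S \<inter> treatment_event p) {1..m}"
      using treatment_event_disjoint unfolding disjoint_family_on_def by blast
  qed (use assms in auto)
  ultimately have "prob (cf_event S) = (\<Sum>p\<in>{1..m}. prob (cf_event S \<inter> treatment_event p))"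
    by simp
  also have "\<dots> = (\<Sum>p\<in>{1..m} - snd ` S. prob (cf_event S \<inter> treatment_event p))
      + (\<Sum>p\<in>snd ` S. prob (cf_event S \<inter> treatment_event p))"
    by (rule sum.subset_diff) (use assms in auto)
  \<comment> \<open>Injectivity of \<open>snd\<close> assigns exactly one pair to each of these
    \<open>p\<close>, so the sum can be reindexed over \<open>S\<close>.\<close>
  also have "(\<Sum>p\<in>snd ` S. prob (cf_event S \<inter> treatment_event p))
      = (\<Sum>(i, j)\<in>S. prob (cf_event (S - {(i, j)}) \<inter> factual_event j i))"
    unfolding sum.reindex[OF assms(2)]
  proof (rule sum.cong[OF refl], clarsimp)
    fix i j assume "(i, j) \<in> S"
    then have "j \<in> {1..m}" using assms(3) by force
    from consistency_event[OF this, of i] cf_event_remove[OF \<open>(i, j) \<in> S\<close>]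
    have "cf_event S \<inter> treatment_event j = cf_event (S - {(i, j)}) \<inter> factual_event j i" by auto
    then show "prob (cf_event S \<inter> treatment_event j)
      = prob (cf_event (S - {(i, j)}) \<inter> factual_event j i)" by simp
  qed
  finally show ?thesis by simp
qed

text \<open>The first and third facts license the induction hypothesis at \<open>S - {s}\<close>;
  the second, from injectivity of \<open>snd\<close>, makes the removed treatment index an eligible
  \<open>p\<close> for the remaining pairs.\<close>

lemma admissible_remove:
  assumes "admissible S" "2 \<le> card S" "s \<in> S"
  shows "admissible (S - {s})" "snd s \<in> {1..m} - snd ` (S - {s})" "card (S - {s}) < card S"
proof -
  have "S - {s} \<noteq> {}" using assms card_mono[of "{s}" S] by fastforce
  then show "admissible (S - {s})" "snd s \<in> {1..m} - snd ` (S - {s})"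
    using assms by (auto simp: admissible_def inj_on_def)
  show "card (S - {s}) < card S"
    using assms by (auto simp: admissible_def intro: card_Diff1_less)
qed

lemma admissible_card_less_2:
  assumes "admissible S" "\<not> 2 \<le> card S"
  obtains i j where "S = {(i, j)}" "j \<in> {1..m}"
proof -
  have "card S = 1"
    using assms by (auto simp: admissible_def not_le less_2_cases_iff)
  then obtain s where "S = {s}" by (auto simp: card_1_singleton_iff)
  then show thesis using assms(1) that[of "fst s" "snd s"] by (auto simp: admissible_def)
qed

section \<open>Bounds for conjunctions with a factual event\<close>

abbreviation lower_cf where "lower_cf \<equiv> lower m cf_prob treatment_prob factual_prob"
abbreviation lower_cf_x where "lower_cf_x \<equiv> lower_x m cf_prob treatment_prob factual_prob"
abbreviation lower_cf_xy where "lower_cf_xy \<equiv> lower_xy m cf_prob treatment_prob factual_prob"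
abbreviation upper_cf where "upper_cf \<equiv> upper m cf_prob treatment_prob factual_prob"
abbreviation upper_cf_x where "upper_cf_x \<equiv> upper_x m cf_prob treatment_prob factual_prob"
abbreviation upper_cf_xy where "upper_cf_xy \<equiv> upper_xy m cf_prob treatment_prob factual_prob"

text \<open>As \<open>p \<noteq> j\<close>, the event \<open>X = x p\<close> is disjoint from
  \<open>X = x j\<close>, which the sharpened inequality demands.\<close>

lemma lower_cf_x_singleton_le:
  assumes "j \<in> {1..m}" "p \<in> {1..m}" "p \<noteq> j"
  shows "lower_cf_x {(i, j)} p \<le> prob (cf_event {(i, j)} \<inter> treatment_event p)"
  using prob_cf_event_singleton_Int_ge[OF assms(1) _ treatment_event_disjoint, of p i] assms
  by (simp add: lower_x.simps prob_treatment_event)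

lemma lower_cf_xy_singleton_le:
  assumes "j \<in> {1..m}" "p \<in> {1..m}" "p \<noteq> j"
  shows "lower_cf_xy {(i, j)} p q \<le> prob (cf_event {(i, j)} \<inter> factual_event p q)"
proof -
  have "factual_event p q \<inter> treatment_event j = {}"
    using treatment_event_disjoint[OF assms(2,1,3)] factual_event_subset by blast
  from prob_cf_event_singleton_Int_ge[OF assms(1) _ this, of i]
  show ?thesis by (simp add: lower_xy.simps prob_factual_event)
qed

lemma upper_cf_x_singleton_ge:
  assumes "j \<in> {1..m}" "p \<in> {1..m}" "p \<noteq> j"
  shows "prob (cf_event {(i, j)} \<inter> treatment_event p) \<le> upper_cf_x {(i, j)} p"
  using prob_cf_event_singleton_Int_le[OF assms(1) treatment_event_disjoint, of p i] assms
  by (auto simp: upper_x.simps prob_treatment_event intro!: finite_measure_mono)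

lemma upper_cf_xy_singleton_ge:
  assumes "j \<in> {1..m}" "p \<in> {1..m}" "p \<noteq> j"
  shows "prob (cf_event {(i, j)} \<inter> factual_event p q) \<le> upper_cf_xy {(i, j)} p q"
proof -
  have "factual_event p q \<inter> treatment_event j = {}"
    using treatment_event_disjoint[OF assms(2,1,3)] factual_event_subset by blast
  from prob_cf_event_singleton_Int_le[OF assms(1) this, of i]
  show ?thesis
    by (auto simp: upper_xy.simps prob_factual_event intro!: finite_measure_mono)
qed

text \<open>\<open>l\<close> and \<open>l'\<close> are abstract so that \<open>lower_x\<close> and
  \<open>lower_xy\<close> share one argument: \<open>l\<close> becomes \<open>lower_cf\<close>,
  \<open>l'\<close> the singleton bound, and \<open>B\<close> a treatment or factual event.\<close>

lemma prob_cf_event_Int_ge: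
  assumes "admissible S" "B \<in> events"
    and rem: "\<And>s. s \<in> S \<Longrightarrow> l (S - {s}) \<le> prob (cf_event (S - {s}))"
    and single: "\<And>s. s \<in> S \<Longrightarrow> l' s \<le> prob (cf_event {s} \<inter> B)"
  shows "Max {0, (\<Sum>(i, j)\<in>S. cf_prob i j) + prob B - real (card S),
      (MAX s\<in>S. l (S - {s}) + l' s - 1)} \<le> prob (cf_event S \<inter> B)"
proof -
  have S: "finite S" "S \<noteq> {}" "snd ` S \<subseteq> {1..m}" using assms(1) by (auto simp: admissible_def)
  \<comment> \<open>Joining \<open>B\<close> as one more event uses up the \<open>+ 1\<close> of
    \<open>prob_cf_event_ge\<close>.\<close>
  have "(\<Sum>(i, j)\<in>S. cf_prob i j) + prob B - real (card S) \<le> prob (cf_event S \<inter> B)"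
    using prob_cf_event_ge[OF S(1,3)] prob_Int_ge[OF cf_event_measurable[OF S(1,3)] assms(2)]
    by simp
  moreover have "l (S - {s}) + l' s - 1 \<le> prob (cf_event S \<inter> B)" if "s \<in> S" for s
    using prob_cf_event_Int_ge_remove[OF S(1,3) that assms(2)] rem[OF that] single[OF that] by simp
  ultimately show ?thesis using S by auto
qed

text \<open>The four entries bound larger events: a single conjunct, \<open>B\<close>, all conjuncts
  but one, and a single conjunct together with \<open>B\<close>.\<close>

lemma prob_cf_event_Int_le:
  assumes "admissible S" "B \<in> events"
    and rem: "\<And>s. s \<in> S \<Longrightarrow> prob (cf_event (S - {s})) \<le> u (S - {s})"
    and single: "\<And>s. s \<in> S \<Longrightarrow> prob (cf_event {s} \<inter> B) \<le> u' s"
  shows "prob (cf_event S \<inter> B) \<le> Min {(MIN (i, j)\<in>S. cf_prob i j), prob B,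
      (MIN s\<in>S. u (S - {s})), (MIN s\<in>S. u' s)}"
proof -
  have S: "finite S" "S \<noteq> {}" "snd ` S \<subseteq> {1..m}" using assms(1) by (auto simp: admissible_def)
  note mono = prob_cf_event_Int_mono[OF S(1,3) _ assms(2)]
  have "prob (cf_event S \<inter> B) \<le> cf_prob i j" if "(i, j) \<in> S" for i j
    using mono(2)[of "{(i, j)}"] that by (simp add: prob_cf_event_singleton)
  moreover have "prob (cf_event S \<inter> B) \<le> prob B"
    using assms(2) by (intro finite_measure_mono) auto
  moreover have "prob (cf_event S \<inter> B) \<le> u (S - {s})" if "s \<in> S" for s
    using mono(2)[of "S - {s}"] rem[OF that] by auto
  moreover have "prob (cf_event S \<inter> B) \<le> u' s" if "s \<in> S" for s
    using mono(1)[of "{s}"] single[OF that] that by auto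
  ultimately show ?thesis using S by auto
qed

section \<open>Soundness of the lower bounds\<close>

text \<open>\<open>rem\<close> is the induction hypothesis of \<open>lower_cf_sound\<close> made
  explicit, so that the mutual recursion needs a single induction. Its guard excludes singletons,
  where \<open>S - {s}\<close> would be empty.\<close>

lemma lower_cf_x_sound:
  assumes "admissible S" "p \<in> {1..m} - snd ` S"
    and rem: "\<And>s. 2 \<le> card S \<Longrightarrow> s \<in> S \<Longrightarrow> lower_cf (S - {s}) \<le> prob (cf_event (S - {s}))"
  shows "lower_cf_x S p \<le> prob (cf_event S \<inter> treatment_event p)"
proof (cases "2 \<le> card S")
  case True
  have "lower_cf_x {s} p \<le> prob (cf_event {s} \<inter> treatment_event p)" if "s \<in> S" for s
    using lower_cf_x_singleton_le[of "snd s" p "fst s"] assms(1,2) that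
    by (force simp: admissible_def)
  from prob_cf_event_Int_ge[OF assms(1) treatment_event_measurable rem[OF True] this]
  show ?thesis using True by (subst lower_x.simps) (simp add: prob_treatment_event)
next
  case False
  then obtain i j where "S = {(i, j)}" "j \<in> {1..m}"
    using admissible_card_less_2 assms(1) by blast
  then show ?thesis using lower_cf_x_singleton_le assms(2) by auto
qed

lemma lower_cf_xy_sound:
  assumes "admissible S" "p \<in> {1..m} - snd ` S"
    and rem: "\<And>s. 2 \<le> card S \<Longrightarrow> s \<in> S \<Longrightarrow> lower_cf (S - {s}) \<le> prob (cf_event (S - {s}))"
  shows "lower_cf_xy S p q \<le> prob (cf_event S \<inter> factual_event p q)"
proof (cases "2 \<le> card S")
  case True
  have "lower_cf_xy {s} p q \<le> prob (cf_event {s} \<inter> factual_event p q)" if "s \<in> S" for s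
    using lower_cf_xy_singleton_le[of "snd s" p "fst s"] assms(1,2) that
    by (force simp: admissible_def)
  from prob_cf_event_Int_ge[OF assms(1) factual_event_measurable rem[OF True] this]
  show ?thesis using True by (subst lower_xy.simps) (simp add: prob_factual_event)
next
  case False
  then obtain i j where "S = {(i, j)}" "j \<in> {1..m}"
    using admissible_card_less_2 assms(1) by blast
  then show ?thesis using lower_cf_xy_singleton_le assms(2) by auto
qed

lemma lower_cf_sound: "admissible S \<Longrightarrow> lower_cf S \<le> prob (cf_event S)"
proof (induction "card S" arbitrary: S rule: less_induct)
  case less
  show ?case
  proof (cases "2 \<le> card S")
    case True
    have S: "finite S" "S \<noteq> {}" "inj_on snd S" "snd ` S \<subseteq> {1..m}"
      using less.prems by (auto simp: admissible_def)
    have "lower_cf (S - {(i, j)}) + cf_prob i j - 1 \<le> prob (cf_event S)" if "(i, j) \<in> S" for i j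
    proof -
      have "lower_cf (S - {(i, j)}) \<le> prob (cf_event (S - {(i, j)}))"
        using less.hyps admissible_remove(1,3)[OF less.prems True that] by blast
      \<comment> \<open>Taking \<open>B\<close> to be \<open>space M\<close> specialises the
        inequality to a plain conjunction.\<close>
      moreover have "prob (cf_event (S - {(i, j)})) + prob (cf_event {(i, j)} \<inter> space M) - 1
          \<le> prob (cf_event S \<inter> space M)"
        by (rule prob_cf_event_Int_ge_remove[OF S(1,4) that]) simp
      moreover have "cf_event T \<inter> space M = cf_event T" for T by (auto simp: cf_event_def)
      ultimately show ?thesis by (simp add: prob_cf_event_singleton)
    qed
    moreover have "(\<Sum>(i, j)\<in>S. lower_cf_xy (S - {(i, j)}) j i)
        + (\<Sum>p\<in>{1..m} - snd ` S. lower_cf_x S p) \<le> prob (cf_event S)"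
      unfolding prob_cf_event_split[OF S(1,3,4)]
    \<comment> \<open>Although \<open>lower_cf_x\<close> is taken at \<open>S\<close> itself, it
      refers to \<open>lower_cf\<close> only at sets \<open>S - {s}\<close>, which the induction
      hypothesis covers.\<close>
    proof (intro add_mono sum_mono lower_cf_x_sound less.prems less.hyps admissible_remove)
      fix s assume s: "s \<in> S"
      note rem = admissible_remove[OF less.prems True s]
      have "lower_cf_xy (S - {s}) (snd s) (fst s)
          \<le> prob (cf_event (S - {s}) \<inter> factual_event (snd s) (fst s))"
        \<comment> \<open>\<open>lower_cf_xy\<close> at \<open>S - {s}\<close> descends to
          \<open>S\<close> minus two pairs, hence the transitivity of \<open><\<close> on
          cardinalities.\<close>
        using less.hyps admissible_remove rem by (intro lower_cf_xy_sound) (auto intro: less_trans)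
      then show "(case s of (i, j) \<Rightarrow> lower_cf_xy (S - {(i, j)}) j i)
          \<le> (case s of (i, j) \<Rightarrow> prob (cf_event (S - {(i, j)}) \<inter> factual_event j i))"
        by (cases s) simp
    qed
    ultimately show ?thesis
      using True S prob_cf_event_ge[OF S(1,4)] by (subst lower.simps) auto
  next
    case False
    then obtain i j where "S = {(i, j)}" using admissible_card_less_2 less.prems by blast
    then show ?thesis by (simp add: lower.simps prob_cf_event_singleton)
  qed
qed

section \<open>Soundness of the upper bounds\<close>

lemma upper_cf_x_sound:
  assumes "admissible S" "p \<in> {1..m} - snd ` S"
    and rem: "\<And>s. 2 \<le> card S \<Longrightarrow> s \<in> S \<Longrightarrow> prob (cf_event (S - {s})) \<le> upper_cf (S - {s})"
  shows "prob (cf_event S \<inter> treatment_event p) \<le> upper_cf_x S p"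
proof (cases "2 \<le> card S")
  case True
  have "prob (cf_event {s} \<inter> treatment_event p) \<le> upper_cf_x {s} p" if "s \<in> S" for s
    using upper_cf_x_singleton_ge[of "snd s" p "fst s"] assms(1,2) that
    by (force simp: admissible_def)
  from prob_cf_event_Int_le[OF assms(1) treatment_event_measurable rem[OF True] this]
  show ?thesis using True by (subst upper_x.simps) (simp add: prob_treatment_event)
next
  case False
  then obtain i j where "S = {(i, j)}" "j \<in> {1..m}"
    using admissible_card_less_2 assms(1) by blast
  then show ?thesis using upper_cf_x_singleton_ge assms(2) by auto
qed

lemma upper_cf_xy_sound:
  assumes "admissible S" "p \<in> {1..m} - snd ` S"
    and rem: "\<And>s. 2 \<le> card S \<Longrightarrow> s \<in> S \<Longrightarrow> prob (cf_event (S - {s})) \<le> upper_cf (S - {s})"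
  shows "prob (cf_event S \<inter> factual_event p q) \<le> upper_cf_xy S p q"
proof (cases "2 \<le> card S")
  case True
  have "prob (cf_event {s} \<inter> factual_event p q) \<le> upper_cf_xy {s} p q" if "s \<in> S" for s
    using upper_cf_xy_singleton_ge[of "snd s" p "fst s"] assms(1,2) that
    by (force simp: admissible_def)
  from prob_cf_event_Int_le[OF assms(1) factual_event_measurable rem[OF True] this]
  show ?thesis using True by (subst upper_xy.simps) (simp add: prob_factual_event)
next
  case False
  then obtain i j where "S = {(i, j)}" "j \<in> {1..m}"
    using admissible_card_less_2 assms(1) by blast
  then show ?thesis using upper_cf_xy_singleton_ge assms(2) by auto
qed

text \<open>Dropping conjuncts yields the first two entries of \<open>upper\<close>; the sum is the
  termwise estimate of \<open>prob_cf_event_split\<close>.\<close>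

lemma upper_cf_sound: "admissible S \<Longrightarrow> prob (cf_event S) \<le> upper_cf S"
proof (induction "card S" arbitrary: S rule: less_induct)
  case less
  show ?case
  proof (cases "2 \<le> card S")
    case True
    have S: "finite S" "S \<noteq> {}" "inj_on snd S" "snd ` S \<subseteq> {1..m}"
      using less.prems by (auto simp: admissible_def)
    have mono: "prob (cf_event S) \<le> prob (cf_event T)" if "T \<subseteq> S" for T
    proof -
      have "cf_event T \<in> events"
        using that S by (intro cf_event_measurable) (auto dest: finite_subset)
      then show ?thesis using cf_event_antimono[OF that] by (rule finite_measure_mono[rotated])
    qed
    have "prob (cf_event S) \<le> cf_prob i j" if "(i, j) \<in> S" for i j
      using mono[of "{(i, j)}"] that by (simp add: prob_cf_event_singleton)
    moreover have "prob (cf_event S) \<le> upper_cf (S - {s})" if "s \<in> S" for s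
      using mono[of "S - {s}"] less.hyps admissible_remove(1,3)[OF less.prems True that]
      by fastforce
    moreover have "prob (cf_event S) \<le> (\<Sum>(i, j)\<in>S. upper_cf_xy (S - {(i, j)}) j i)
        + (\<Sum>p\<in>{1..m} - snd ` S. upper_cf_x S p)"
      unfolding prob_cf_event_split[OF S(1,3,4)]
    proof (intro add_mono sum_mono upper_cf_x_sound less.prems less.hyps admissible_remove)
      fix s assume s: "s \<in> S"
      note rem = admissible_remove[OF less.prems True s]
      have "prob (cf_event (S - {s}) \<inter> factual_event (snd s) (fst s))
          \<le> upper_cf_xy (S - {s}) (snd s) (fst s)"
        using less.hyps admissible_remove rem by (intro upper_cf_xy_sound) (auto intro: less_trans)
      then show "(case s of (i, j) \<Rightarrow> prob (cf_event (S - {(i, j)}) \<inter> factual_event j i))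
          \<le> (case s of (i, j) \<Rightarrow> upper_cf_xy (S - {(i, j)}) j i)"
        by (cases s) simp
    qed
    ultimately show ?thesis
      using True S by (subst upper.simps) auto
  next
    case False
    then obtain i j where "S = {(i, j)}" using admissible_card_less_2 less.prems by blast
    then show ?thesis by (simp add: upper.simps prob_cf_event_singleton)
  qed
qed

end

section \<open>From indexed families to sets of pairs\<close>

theorem theorem8:
  fixes M :: "'w measure"
    and m n k :: nat
    and x :: "nat \<Rightarrow> 'a" and y :: "nat \<Rightarrow> 'b"
    and X :: "'w \<Rightarrow> 'a" and Y :: "'w \<Rightarrow> 'b" and Yc :: "'a \<Rightarrow> 'w \<Rightarrow> 'b"
    and i j :: "nat \<Rightarrow> nat"
  defines "a \<equiv> \<lambda>u v. measure M {\<omega> \<in> space M. Yc (x v) \<omega> = y u}"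
    and "px \<equiv> \<lambda>p. measure M {\<omega> \<in> space M. X \<omega> = x p}"
    and "pxy \<equiv> \<lambda>p q. measure M {\<omega> \<in> space M. X \<omega> = x p \<and> Y \<omega> = y q}"
    and "S \<equiv> (\<lambda>t. (i t, j t)) ` {1..k}"
    and "J \<equiv> j ` {1..k}"
  assumes "potential_outcomes M m n x y X Y Yc"
    and "k \<ge> 2"
    and "\<And>t. t \<in> {1..k} \<Longrightarrow> i t \<in> {1..n}"
    and "\<And>t. t \<in> {1..k} \<Longrightarrow> j t \<in> {1..m}"
    and "inj_on j {1..k}"
  shows "measure M {\<omega> \<in> space M. \<forall>t\<in>{1..k}. Yc (x (j t)) \<omega> = y (i t)}
      \<ge> Max {0,
             (\<Sum>t=1..k. a (i t) (j t)) - real k + 1,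
             (MAX t\<in>{1..k}. lower m a px pxy (S - {(i t, j t)}) + a (i t) (j t) - 1),
             (\<Sum>r=1..k. lower_xy m a px pxy (S - {(i r, j r)}) (j r) (i r))
               + (\<Sum>p\<in>{1..m} - J. lower_x m a px pxy S p)}
    \<and> measure M {\<omega> \<in> space M. \<forall>t\<in>{1..k}. Yc (x (j t)) \<omega> = y (i t)}
      \<le> Min {(MIN t\<in>{1..k}. a (i t) (j t)),
             (MIN t\<in>{1..k}. upper m a px pxy (S - {(i t, j t)})),
             (\<Sum>r=1..k. upper_xy m a px pxy (S - {(i r, j r)}) (j r) (i r))
               + (\<Sum>p\<in>{1..m} - J. upper_x m a px pxy S p)}"
proof -
  interpret potential_outcomes M m n x y X Y Yc by (rule assms(6))
  note k = assms(7) and j = assms(9,10)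
  \<comment> \<open>Distinct \<open>j t\<close> keep the pairs distinct, so \<open>S\<close> has
    exactly \<open>k\<close> elements and sums over \<open>t\<close> lose no term when written over
    \<open>S\<close>.\<close>
  have inj: "inj_on (\<lambda>t. (i t, j t)) {1..k}"
    using j(2) by (auto intro!: inj_onI dest: inj_onD)
  have card: "card S = k" using card_image[OF inj] by (simp add: S_def)
  have snd: "snd ` S = J" by (simp add: S_def J_def image_image)
  have "J \<subseteq> {1..m}" using j(1) unfolding J_def by blast
  \<comment> \<open>\<open>snd\<close> after the pairing is \<open>j\<close>, so injectivity of
    \<open>j\<close> passes to \<open>snd\<close> on \<open>S\<close>.\<close>
  then have adm: "admissible S"
    unfolding admissible_def snd using k j(2) inj_on_imageI[of snd "\<lambda>t. (i t, j t)" "{1..k}"]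
    by (simp add: S_def o_def)
  have event: "{\<omega> \<in> space M. \<forall>t\<in>{1..k}. Yc (x (j t)) \<omega> = y (i t)} = cf_event S"
    by (simp add: cf_event_def S_def)
  have sum: "(\<Sum>s\<in>S. g s) = (\<Sum>t=1..k. g (i t, j t))" for g :: "nat \<times> nat \<Rightarrow> real"
    by (simp only: S_def sum.reindex[OF inj] o_def)
  have img: "g ` S = (\<lambda>t. g (i t, j t)) ` {1..k}" for g :: "nat \<times> nat \<Rightarrow> real"
    by (simp add: S_def image_image)
  \<comment> \<open>One unfolding of the recursion at \<open>S\<close> gives precisely the claimed
    maximum, so soundness at \<open>S\<close> suffices; likewise for \<open>upper\<close>
    below.\<close>
  have "lower m a px pxy S = Max {0,
      (\<Sum>t=1..k. a (i t) (j t)) - real k + 1,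
      (MAX t\<in>{1..k}. lower m a px pxy (S - {(i t, j t)}) + a (i t) (j t) - 1),
      (\<Sum>r=1..k. lower_xy m a px pxy (S - {(i r, j r)}) (j r) (i r))
        + (\<Sum>p\<in>{1..m} - J. lower_x m a px pxy S p)}"
    by (subst lower.simps) (simp only: card snd sum img case_prod_conv if_True k)
  moreover have "lower m a px pxy S \<le> prob (cf_event S)"
    unfolding a_def px_def pxy_def by (rule lower_cf_sound[OF adm])
  moreover have "upper m a px pxy S = Min {(MIN t\<in>{1..k}. a (i t) (j t)),
      (MIN t\<in>{1..k}. upper m a px pxy (S - {(i t, j t)})),
      (\<Sum>r=1..k. upper_xy m a px pxy (S - {(i r, j r)}) (j r) (i r))
        + (\<Sum>p\<in>{1..m} - J. upper_x m a px pxy S p)}"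
    by (subst upper.simps) (simp only: card snd sum img case_prod_conv if_True k)
  moreover have "prob (cf_event S) \<le> upper m a px pxy S"
    unfolding a_def px_def pxy_def by (rule upper_cf_sound[OF adm])
  ultimately show ?thesis by (simp only: event)
qed

end
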